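(* Let $R$ be an integral domain. There is an amalgamated free product decomposition $$E_2(R[t])\cong E_2(R) *_{B(R)} B(R[t]),$$ i.e. the natural homomorphism from the amalgamated free product of $E_2(R)$ and $B(R[t])$ along their common subgroup $B(R)$ to $E_2(R[t])$, induced by the inclusions, is an isomorphism.
   Context: For a commutative ring $A$, $E_2(A)$ denotes the subgroup of $GL_2(A)$ generated by the elementary matrices, and $B(A)$ denotes the subgroup of upper triangular matrices in $SL_2(A)$ (for every commutative ring $A$ it is contained in $E_2(A)$). *)

theory Defs
  imports
    "HOL-Algebra.Generated_Groups"
    "HOL-Computational_Algebra.Polynomial"
    "HOL-Analysis.Determinants"
begin

section \<open>Amalgamated free products\<close>

text \<open>
  The amalgamated free product of \<open>G\<close> and \<open>H\<close> along \<open>i : C \<rightarrow> G\<close> and \<open>j : C \<rightarrow> H\<close>: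
  words in the letters of \<open>G\<close> and \<open>H\<close> modulo the congruence that makes both inclusions
  homomorphisms and identifies \<open>i c\<close> with \<open>j c\<close>.
\<close>

definition amalg_words ::
  "('a, 'm) monoid_scheme \<Rightarrow> ('b, 'n) monoid_scheme \<Rightarrow> ('a + 'b) list set"
  where "amalg_words G H = lists (carrier G <+> carrier H)"

inductive_set amalg_rel ::
  "('c, 'k) monoid_scheme \<Rightarrow> ('a, 'm) monoid_scheme \<Rightarrow> ('b, 'n) monoid_scheme \<Rightarrow>
   ('c \<Rightarrow> 'a) \<Rightarrow> ('c \<Rightarrow> 'b) \<Rightarrow> (('a + 'b) list \<times> ('a + 'b) list) set"
  for C G H i j where
  refl: "w \<in> amalg_words G H \<Longrightarrow> (w, w) \<in> amalg_rel C G H i j"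
| sym: "(u, v) \<in> amalg_rel C G H i j \<Longrightarrow> (v, u) \<in> amalg_rel C G H i j"
| trans: "\<lbrakk>(u, v) \<in> amalg_rel C G H i j; (v, w) \<in> amalg_rel C G H i j\<rbrakk>
    \<Longrightarrow> (u, w) \<in> amalg_rel C G H i j"
| append: "\<lbrakk>(u, u') \<in> amalg_rel C G H i j; (v, v') \<in> amalg_rel C G H i j\<rbrakk>
    \<Longrightarrow> (u @ v, u' @ v') \<in> amalg_rel C G H i j"
| one_left: "([Inl \<one>\<^bsub>G\<^esub>], []) \<in> amalg_rel C G H i j"
| one_right: "([Inr \<one>\<^bsub>H\<^esub>], []) \<in> amalg_rel C G H i j"
| mult_left: "\<lbrakk>x \<in> carrier G; y \<in> carrier G\<rbrakk>
    \<Longrightarrow> ([Inl x, Inl y], [Inl (x \<otimes>\<^bsub>G\<^esub> y)]) \<in> amalg_rel C G H i j"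
| mult_right: "\<lbrakk>x \<in> carrier H; y \<in> carrier H\<rbrakk>
    \<Longrightarrow> ([Inr x, Inr y], [Inr (x \<otimes>\<^bsub>H\<^esub> y)]) \<in> amalg_rel C G H i j"
| amalg: "c \<in> carrier C \<Longrightarrow> ([Inl (i c)], [Inr (j c)]) \<in> amalg_rel C G H i j"

definition amalg_product ::
  "('c, 'k) monoid_scheme \<Rightarrow> ('a, 'm) monoid_scheme \<Rightarrow> ('b, 'n) monoid_scheme \<Rightarrow>
   ('c \<Rightarrow> 'a) \<Rightarrow> ('c \<Rightarrow> 'b) \<Rightarrow> ('a + 'b) list set monoid"
  where "amalg_product C G H i j =
    \<lparr>carrier = amalg_words G H // amalg_rel C G H i j,
     monoid.mult = (\<lambda>X Y. \<Union>u\<in>X. \<Union>v\<in>Y. amalg_rel C G H i j `` {u @ v}),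
     one = amalg_rel C G H i j `` {[]}\<rparr>"

definition amalg_eval ::
  "('d, 'k) monoid_scheme \<Rightarrow> ('a \<Rightarrow> 'd) \<Rightarrow> ('b \<Rightarrow> 'd) \<Rightarrow> ('a + 'b) list \<Rightarrow> 'd"
  where "amalg_eval K f g w = foldr (\<lambda>l z. case_sum f g l \<otimes>\<^bsub>K\<^esub> z) w \<one>\<^bsub>K\<^esub>"

text \<open>
  The homomorphism out of the amalgamated product induced by homomorphisms \<open>f\<close> and \<open>g\<close> into \<open>K\<close>
  that agree on \<open>C\<close>: by \<open>amalg_eval_cong\<close> below, evaluation is constant on each class.
\<close>

definition amalg_lift ::
  "('d, 'k) monoid_scheme \<Rightarrow> ('a \<Rightarrow> 'd) \<Rightarrow> ('b \<Rightarrow> 'd) \<Rightarrow> ('a + 'b) list set \<Rightarrow> 'd"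
  where "amalg_lift K f g X = the_elem (amalg_eval K f g ` X)"

locale amalg_data =
  C: group C + G: group G + H: group H
  for C :: "('c, 'k) monoid_scheme" and G :: "('a, 'm) monoid_scheme"
    and H :: "('b, 'n) monoid_scheme" +
  fixes i :: "'c \<Rightarrow> 'a" and j :: "'c \<Rightarrow> 'b"
  assumes i_hom: "i \<in> hom C G" and j_hom: "j \<in> hom C H"
begin

abbreviation "W \<equiv> amalg_words G H"
abbreviation "R \<equiv> amalg_rel C G H i j"
abbreviation "P \<equiv> amalg_product C G H i j"

lemma words_simps [simp]:
  "[] \<in> W" "Inl x # w \<in> W \<longleftrightarrow> x \<in> carrier G \<and> w \<in> W"
  "Inr y # w \<in> W \<longleftrightarrow> y \<in> carrier H \<and> w \<in> W"
  "u @ v \<in> W \<longleftrightarrow> u \<in> W \<and> v \<in> W"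
  by (auto simp: amalg_words_def)

lemma rel_words: "(u, v) \<in> R \<Longrightarrow> u \<in> W \<and> v \<in> W"
  by (induction rule: amalg_rel.induct) (use i_hom j_hom in \<open>auto simp: hom_def\<close>)

lemma equiv_rel: "equiv W R"
  by (rule equivI)
    (auto simp: refl_on_def sym_def trans_def dest: rel_words
      intro: amalg_rel.refl amalg_rel.sym amalg_rel.trans)

lemma class_mult:
  assumes "u \<in> W" "v \<in> W"
  shows "R `` {u} \<otimes>\<^bsub>P\<^esub> R `` {v} = R `` {u @ v}"
proof -
  have eq: "R `` {u' @ v'} = R `` {u @ v}" if "(u, u') \<in> R" "(v, v') \<in> R" for u' v'
    using equiv_class_eq[OF equiv_rel amalg_rel.append[OF that]] by simp
  have "(u, u) \<in> R" "(v, v) \<in> R"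
    using assms by (auto intro: amalg_rel.refl)
  then have ne: "R `` {u} \<noteq> {}" "R `` {v} \<noteq> {}" by blast+
  have "R `` {u} \<otimes>\<^bsub>P\<^esub> R `` {v} = (\<Union>u'\<in>R `` {u}. \<Union>v'\<in>R `` {v}. R `` {u' @ v'})"
    by (simp add: amalg_product_def)
  also have "\<dots> = (\<Union>u'\<in>R `` {u}. \<Union>v'\<in>R `` {v}. R `` {u @ v})"
    by (intro SUP_cong HOL.refl eq) auto
  also have "\<dots> = R `` {u @ v}" using ne by simp
  finally show ?thesis .
qed

lemma carrier_P: "carrier P = (\<lambda>w. R `` {w}) ` W"
  by (auto simp: amalg_product_def quotient_def)

lemma one_P: "\<one>\<^bsub>P\<^esub> = R `` {[]}"
  by (simp add: amalg_product_def)

lemma word_inverse: "w \<in> W \<Longrightarrow> \<exists>w'\<in>W. (w' @ w, []) \<in> R"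
proof (induction w)
  case Nil
  then show ?case by (auto intro!: bexI[of _ "[]"] amalg_rel.refl)
next
  case (Cons l w)
  then have w: "w \<in> W" by (cases l) auto
  with Cons obtain w' where w': "w' \<in> W" "(w' @ w, []) \<in> R" by blast
  have "\<exists>l'. [l'] \<in> W \<and> ([l', l], []) \<in> R"
  proof (cases l)
    case (Inl x)
    with Cons.prems have "x \<in> carrier G" by simp
    then have "([Inl (inv\<^bsub>G\<^esub> x), Inl x], [Inl \<one>\<^bsub>G\<^esub>]) \<in> R"
      using amalg_rel.mult_left[of "inv\<^bsub>G\<^esub> x" G x C H i j] by simp
    then have "([Inl (inv\<^bsub>G\<^esub> x), Inl x], []) \<in> R"
      using amalg_rel.one_left amalg_rel.trans by metis
    then show ?thesis using Inl \<open>x \<in> carrier G\<close> by (intro exI[of _ "Inl (inv\<^bsub>G\<^esub> x)"]) auto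
  next
    case (Inr x)
    with Cons.prems have "x \<in> carrier H" by simp
    then have "([Inr (inv\<^bsub>H\<^esub> x), Inr x], [Inr \<one>\<^bsub>H\<^esub>]) \<in> R"
      using amalg_rel.mult_right[of "inv\<^bsub>H\<^esub> x" H x C G i j] by simp
    then have "([Inr (inv\<^bsub>H\<^esub> x), Inr x], []) \<in> R"
      using amalg_rel.one_right amalg_rel.trans by metis
    then show ?thesis using Inr \<open>x \<in> carrier H\<close> by (intro exI[of _ "Inr (inv\<^bsub>H\<^esub> x)"]) auto
  qed
  then obtain l' where l': "[l'] \<in> W" "([l', l], []) \<in> R" by blast
  have "(w' @ ([l', l] @ w), w' @ ([] @ w)) \<in> R"
    by (intro amalg_rel.append amalg_rel.refl l' w' w)
  then have "(w' @ ([l', l] @ w), []) \<in> R"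
    using w' amalg_rel.trans by fastforce
  then show ?case
    using l' w' by (intro bexI[of _ "w' @ [l']"]) auto
qed

lemma group_P: "group P"
proof (rule groupI)
  fix X assume "X \<in> carrier P"
  then obtain w where w: "w \<in> W" "X = R `` {w}" by (auto simp: carrier_P)
  then obtain w' where w': "w' \<in> W" "(w' @ w, []) \<in> R" using word_inverse by blast
  then have "R `` {w'} \<otimes>\<^bsub>P\<^esub> X = \<one>\<^bsub>P\<^esub>"
    using w equiv_class_eq[OF equiv_rel w'(2)] by (simp add: class_mult one_P)
  then show "\<exists>Y\<in>carrier P. Y \<otimes>\<^bsub>P\<^esub> X = \<one>\<^bsub>P\<^esub>"
    using w' by (auto simp: carrier_P)
qed (auto simp: carrier_P one_P class_mult)

lemma inl_hom: "(\<lambda>x. R `` {[Inl x]}) \<in> hom G P"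
  using equiv_class_eq[OF equiv_rel amalg_rel.mult_left]
  by (auto simp: hom_def carrier_P class_mult)

lemma inr_hom: "(\<lambda>y. R `` {[Inr y]}) \<in> hom H P"
  using equiv_class_eq[OF equiv_rel amalg_rel.mult_right]
  by (auto simp: hom_def carrier_P class_mult)

lemma inl_inr: "c \<in> carrier C \<Longrightarrow> R `` {[Inl (i c)]} = R `` {[Inr (j c)]}"
  by (rule equiv_class_eq[OF equiv_rel amalg_rel.amalg])

end

locale amalg_cocone =
  amalg_data C G H i j + K: group K
  for C :: "('c, 'k) monoid_scheme" and G :: "('a, 'm) monoid_scheme"
    and H :: "('b, 'n) monoid_scheme" and i j and K :: "('d, 'l) monoid_scheme" +
  fixes f :: "'a \<Rightarrow> 'd" and g :: "'b \<Rightarrow> 'd"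
  assumes f_hom: "f \<in> hom G K" and g_hom: "g \<in> hom H K"
    and agree: "\<And>c. c \<in> carrier C \<Longrightarrow> f (i c) = g (j c)"
begin

lemma eval_simps [simp]:
  "amalg_eval K f g [] = \<one>\<^bsub>K\<^esub>"
  "amalg_eval K f g (l # w) = case_sum f g l \<otimes>\<^bsub>K\<^esub> amalg_eval K f g w"
  by (simp_all add: amalg_eval_def)

lemma letter_closed: "l \<in> carrier G <+> carrier H \<Longrightarrow> case_sum f g l \<in> carrier K"
  using f_hom g_hom by (auto simp: hom_def)

lemma eval_closed: "w \<in> W \<Longrightarrow> amalg_eval K f g w \<in> carrier K"
  by (induction w) (auto simp: amalg_words_def letter_closed simp del: Plus_def)

lemma eval_append:
  "u \<in> W \<Longrightarrow> v \<in> W \<Longrightarrow>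
    amalg_eval K f g (u @ v) = amalg_eval K f g u \<otimes>\<^bsub>K\<^esub> amalg_eval K f g v"
proof (induction u)
  case (Cons l u)
  then have "case_sum f g l \<in> carrier K" "u \<in> W"
    by (auto simp: amalg_words_def intro: letter_closed)
  with Cons show ?case by (simp add: eval_closed K.m_assoc)
qed (simp add: eval_closed)

lemma amalg_eval_cong: "(u, v) \<in> R \<Longrightarrow> amalg_eval K f g u = amalg_eval K f g v"
proof (induction rule: amalg_rel.induct)
  case (append u u' v v')
  then show ?case by (metis eval_append rel_words)
next
  case one_left
  then show ?case using hom_one[OF f_hom G.is_group K.is_group] by simp
next
  case one_right
  then show ?case using hom_one[OF g_hom H.is_group K.is_group] by simp
next
  case (mult_left x y)
  then show ?case using f_hom by (auto simp: hom_def Pi_def K.m_assoc)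
next
  case (mult_right x y)
  then show ?case using g_hom by (auto simp: hom_def Pi_def K.m_assoc)
qed (auto simp: agree)

lemma amalg_lift_class: "w \<in> W \<Longrightarrow> amalg_lift K f g (R `` {w}) = amalg_eval K f g w"
proof -
  assume "w \<in> W"
  then have "(w, w) \<in> R" by (rule amalg_rel.refl)
  then have "amalg_eval K f g w \<in> amalg_eval K f g ` (R `` {w})" by blast
  moreover have "z = amalg_eval K f g w" if "z \<in> amalg_eval K f g ` (R `` {w})" for z
    using that by (elim imageE ImageE) (metis amalg_eval_cong singletonD)
  ultimately have "amalg_eval K f g ` (R `` {w}) = {amalg_eval K f g w}" by blast
  then show ?thesis by (simp add: amalg_lift_def)
qed

lemma amalg_lift_hom: "amalg_lift K f g \<in> hom P K"
  by (auto simp: hom_def carrier_P amalg_lift_class class_mult eval_closed eval_append)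

lemma amalg_lift_inl: "x \<in> carrier G \<Longrightarrow> amalg_lift K f g (R `` {[Inl x]}) = f x"
  using hom_in_carrier[OF f_hom] by (simp add: amalg_lift_class)

lemma amalg_lift_inr: "y \<in> carrier H \<Longrightarrow> amalg_lift K f g (R `` {[Inr y]}) = g y"
  using hom_in_carrier[OF g_hom] by (simp add: amalg_lift_class)

lemma amalg_lift_unique:
  assumes h: "h \<in> hom P K"
    and l: "\<And>x. x \<in> carrier G \<Longrightarrow> h (R `` {[Inl x]}) = f x"
    and r: "\<And>y. y \<in> carrier H \<Longrightarrow> h (R `` {[Inr y]}) = g y"
    and X: "X \<in> carrier P"
  shows "h X = amalg_lift K f g X"
proof -
  have "h (R `` {w}) = amalg_eval K f g w" if "w \<in> W" for w
    using that
  proof (induction w)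
    case Nil
    then show ?case using hom_one[OF h group_P K.is_group] by (simp add: one_P)
  next
    case (Cons a w)
    then have w: "w \<in> W" "[a] \<in> W" by (cases a; simp)+
    then have "h (R `` {a # w}) = h (R `` {[a]}) \<otimes>\<^bsub>K\<^esub> h (R `` {w})"
      using hom_mult[OF h, of "R `` {[a]}" "R `` {w}"] by (simp add: carrier_P class_mult)
    then show ?case using Cons w l r by (cases a) auto
  qed
  then show ?thesis using X by (auto simp: carrier_P amalg_lift_class)
qed

end


section \<open>The groups of two-by-two matrices\<close>

definition GL2 :: "('a::comm_ring_1 ^ 2 ^ 2) monoid"
  where "GL2 = \<lparr>carrier = {M. invertible M}, monoid.mult = (**), one = mat 1\<rparr>"

definition elementary_matrix :: "2 \<Rightarrow> 2 \<Rightarrow> 'a::comm_ring_1 \<Rightarrow> 'a ^ 2 ^ 2"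
  where "elementary_matrix p q a =
    (\<chi> k l. if k = p \<and> l = q then a else if k = l then 1 else 0)"

definition E2 :: "('a::comm_ring_1 ^ 2 ^ 2) monoid"
  where "E2 = GL2\<lparr>carrier := generate GL2 {elementary_matrix p q a | p q a. p \<noteq> q}\<rparr>"

definition B2 :: "('a::comm_ring_1 ^ 2 ^ 2) monoid"
  where "B2 = GL2\<lparr>carrier := {M. det M = 1 \<and> M $ 2 $ 1 = 0}\<rparr>"

definition const_matrix :: "'a::comm_ring_1 ^ 2 ^ 2 \<Rightarrow> 'a poly ^ 2 ^ 2"
  where "const_matrix = map_matrix (\<lambda>c. [:c:])"

lemma mat2_eq_iff: "M = N \<longleftrightarrow>
    M $ 1 $ 1 = N $ 1 $ 1 \<and> M $ 1 $ 2 = N $ 1 $ 2 \<and> M $ 2 $ 1 = N $ 2 $ 1 \<and> M $ 2 $ 2 = N $ 2 $ 2"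
  for M N :: "'a ^ 2 ^ 2"
  by (auto simp: vec_eq_iff forall_2)

lemma mult2_nth: "(M ** N) $ p $ q = M $ p $ 1 * N $ 1 $ q + M $ p $ 2 * N $ 2 $ q"
  for M N :: "'a::comm_ring_1 ^ 2 ^ 2"
  by (simp add: matrix_matrix_mult_def sum_2)

lemma mat2_nth: "(mat 1 :: 'a::comm_ring_1 ^ 2 ^ 2) $ p $ q = (if p = q then 1 else 0)"
  by (simp add: mat_def)

lemma group_GL2: "group (GL2 :: ('a::comm_ring_1 ^ 2 ^ 2) monoid)"
proof (rule groupI)
  fix M N :: "'a ^ 2 ^ 2"
  assume "M \<in> carrier GL2" "N \<in> carrier GL2"
  then obtain M' N' where "M ** M' = mat 1" "M' ** M = mat 1" "N ** N' = mat 1" "N' ** N = mat 1"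
    by (auto simp: GL2_def invertible_def)
  then have "(M ** N) ** (N' ** M') = mat 1" "(N' ** M') ** (M ** N) = mat 1"
    by (metis matrix_mul_assoc matrix_mul_rid)+
  then show "M \<otimes>\<^bsub>GL2\<^esub> N \<in> carrier GL2" by (auto simp: GL2_def invertible_def)
next
  fix M :: "'a ^ 2 ^ 2"
  assume "M \<in> carrier GL2"
  then show "\<exists>N\<in>carrier GL2. N \<otimes>\<^bsub>GL2\<^esub> M = \<one>\<^bsub>GL2\<^esub>"
    by (auto simp: GL2_def invertible_def)
qed (auto simp: GL2_def matrix_mul_assoc invertible_def intro!: exI[of _ "mat 1"])

lemma det1_invertible:
  fixes M :: "'a::comm_ring_1 ^ 2 ^ 2"
  assumes "det M = 1"
  shows "M \<in> carrier GL2"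
proof -
  define N :: "'a ^ 2 ^ 2" where "N = vector [vector [M$2$2, - M$1$2], vector [- M$2$1, M$1$1]]"
  have "M ** N = mat 1" "N ** M = mat 1"
    using assms by (auto simp: mat2_eq_iff mult2_nth mat2_nth N_def det_2 algebra_simps)
  then show ?thesis by (auto simp: GL2_def invertible_def)
qed

lemma elementary_in_GL2:
  "{elementary_matrix p q a | p q a. p \<noteq> q} \<subseteq> carrier (GL2 :: ('a::comm_ring_1 ^ 2 ^ 2) monoid)"
proof -
  have "det (elementary_matrix p q a) = 1" if "p \<noteq> q" for p q and a :: 'a
    using that exhaust_2[of p] exhaust_2[of q] by (auto simp: det_2 elementary_matrix_def)
  then show ?thesis using det1_invertible by blast
qed

lemma subgroup_E2: "subgroup (carrier E2) (GL2 :: ('a::comm_ring_1 ^ 2 ^ 2) monoid)"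
  using group.generate_is_subgroup[OF group_GL2 elementary_in_GL2] by (simp add: E2_def)

lemma group_E2: "group (E2 :: ('a::comm_ring_1 ^ 2 ^ 2) monoid)"
  using subgroup.subgroup_is_group[OF subgroup_E2 group_GL2] by (simp add: E2_def)

lemma subgroup_B2: "subgroup (carrier B2) (GL2 :: ('a::comm_ring_1 ^ 2 ^ 2) monoid)"
proof (rule group.subgroupI[OF group_GL2])
  show "carrier B2 \<subseteq> carrier (GL2 :: ('a ^ 2 ^ 2) monoid)"
    using det1_invertible by (auto simp: B2_def)
  have "mat 1 \<in> carrier (B2 :: ('a ^ 2 ^ 2) monoid)" by (simp add: B2_def mat2_nth)
  then show "carrier (B2 :: ('a ^ 2 ^ 2) monoid) \<noteq> {}" by blast
next
  fix M N :: "'a ^ 2 ^ 2"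
  assume "M \<in> carrier B2" "N \<in> carrier B2"
  then show "M \<otimes>\<^bsub>GL2\<^esub> N \<in> carrier B2"
    by (simp add: B2_def GL2_def det_mul mult2_nth)
next
  fix M :: "'a ^ 2 ^ 2"
  assume M: "M \<in> carrier B2"
  define N :: "'a ^ 2 ^ 2" where "N = vector [vector [M$2$2, - M$1$2], vector [0, M$1$1]]"
  have "N ** M = mat 1" "det N = 1" "N $ 2 $ 1 = 0"
    using M by (auto simp: mat2_eq_iff mult2_nth mat2_nth N_def det_2 B2_def GL2_def algebra_simps)
  moreover from this have "inv\<^bsub>GL2\<^esub> M = N"
    using M by (intro group.inv_equality[OF group_GL2] det1_invertible) (auto simp: GL2_def B2_def)
  ultimately show "inv\<^bsub>GL2\<^esub> M \<in> carrier B2" by (simp add: B2_def)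
qed

lemma group_B2: "group (B2 :: ('a::comm_ring_1 ^ 2 ^ 2) monoid)"
  using subgroup.subgroup_is_group[OF subgroup_B2 group_GL2] by (simp add: B2_def)

lemma B2_le_E2: "carrier B2 \<subseteq> carrier (E2 :: ('a::comm_ring_1 ^ 2 ^ 2) monoid)"
proof
  fix M :: "'a ^ 2 ^ 2"
  assume M: "M \<in> carrier B2"
  define a b d where "a = M $ 1 $ 1" and "b = M $ 1 $ 2" and "d = M $ 2 $ 2"
  have ad: "a * d = 1" "M $ 2 $ 1 = 0" using M by (auto simp: B2_def det_2 a_def d_def)
  have da: "d * a = 1" using ad by (simp add: mult.commute)
  let ?U = "elementary_matrix 1 2 :: 'a \<Rightarrow> _" and ?L = "elementary_matrix 2 1 :: 'a \<Rightarrow> _"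
  have el: "?U x \<in> carrier E2" "?L x \<in> carrier E2" for x
  proof -
    have "(1::2) \<noteq> 2" by simp
    then show "?U x \<in> carrier E2" "?L x \<in> carrier E2"
      unfolding E2_def by (force intro!: generate.incl)+
  qed
  have w: "?U x ** (?L (- y) ** ?U x) = vector [vector [0, x], vector [- y, 0]]" if "x * y = 1" for x y
    using that by (auto simp: mat2_eq_iff mult2_nth elementary_matrix_def algebra_simps)
  have "(?U a ** (?L (- d) ** ?U a)) ** ((?U (-1) ** (?L (- (-1)) ** ?U (-1))) ** ?U (d * b)) = M"
    using ad da by (simp add: w mat2_eq_iff mult2_nth elementary_matrix_def
        flip: a_def b_def d_def mult.assoc)
  moreover have "X ** Y \<in> carrier E2" if "X \<in> carrier E2" "Y \<in> carrier E2" for X Y :: "'a ^ 2 ^ 2"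
    using subgroup.m_closed[OF subgroup_E2 that] by (simp add: GL2_def)
  ultimately show "M \<in> carrier E2" using el by metis
qed

lemma const_matrix_hom_GL2: "const_matrix \<in> hom GL2 (GL2 :: ('a::comm_ring_1 poly ^ 2 ^ 2) monoid)"
proof (rule homI)
  have mult: "const_matrix (M ** N) = const_matrix M ** const_matrix N" for M N :: "'a ^ 2 ^ 2"
    by (simp add: mat2_eq_iff mult2_nth const_matrix_def)
  have one: "const_matrix (mat 1 :: 'a ^ 2 ^ 2) = mat 1"
    by (simp add: mat2_eq_iff mat2_nth const_matrix_def flip: one_pCons)
  fix M N :: "'a ^ 2 ^ 2"
  show "const_matrix (M \<otimes>\<^bsub>GL2\<^esub> N) = const_matrix M \<otimes>\<^bsub>GL2\<^esub> const_matrix N"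
    by (simp add: GL2_def mult)
  assume "M \<in> carrier GL2"
  then show "const_matrix M \<in> carrier GL2"
    by (simp add: GL2_def invertible_def) (metis mult one)
qed

lemma const_matrix_hom_E2: "const_matrix \<in> hom E2 (E2 :: ('a::comm_ring_1 poly ^ 2 ^ 2) monoid)"
proof -
  let ?S = "{elementary_matrix p q a | p q a. p \<noteq> q} :: ('a ^ 2 ^ 2) set"
  let ?T = "{elementary_matrix p q a | p q a. p \<noteq> q} :: ('a poly ^ 2 ^ 2) set"
  have "const_matrix (elementary_matrix p q a) = elementary_matrix p q [:a:]" for p q and a :: 'a
    by (simp add: vec_eq_iff const_matrix_def elementary_matrix_def one_pCons)
  then have "const_matrix ` ?S \<subseteq> ?T" by fastforce
  then have le: "generate GL2 (const_matrix ` ?S) \<subseteq> generate GL2 ?T"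
    by (rule group.mono_generate[OF group_GL2])
  have gh: "group_hom GL2 GL2 (const_matrix :: 'a ^ 2 ^ 2 \<Rightarrow> _)"
    by (intro group_hom.intro group_hom_axioms.intro group_GL2 const_matrix_hom_GL2)
  have im: "const_matrix ` generate GL2 ?S \<subseteq> generate GL2 ?T"
    using le unfolding group_hom.generate_img[OF gh elementary_in_GL2] .
  show ?thesis
  proof (rule homI)
    fix M N :: "'a ^ 2 ^ 2"
    assume M: "M \<in> carrier E2"
    then show "const_matrix M \<in> carrier E2" using im by (auto simp: E2_def)
    assume "N \<in> carrier E2"
    with M have "M \<in> carrier GL2" "N \<in> carrier GL2" using subgroup.subset[OF subgroup_E2] by blast+
    then show "const_matrix (M \<otimes>\<^bsub>E2\<^esub> N) = const_matrix M \<otimes>\<^bsub>E2\<^esub> const_matrix N"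
      using hom_mult[OF const_matrix_hom_GL2] by (simp add: E2_def)
  qed
qed

lemma const_matrix_hom_B2: "const_matrix \<in> hom B2 (B2 :: ('a::comm_ring_1 poly ^ 2 ^ 2) monoid)"
proof -
  have "const_matrix M \<in> carrier B2" if "M \<in> carrier B2" for M :: "'a ^ 2 ^ 2"
    using that by (auto simp: B2_def det_2 const_matrix_def one_pCons mult.commute)
  then show ?thesis
    using hom_mult[OF const_matrix_hom_GL2] subgroup.subset[OF subgroup_B2]
    by (auto simp: hom_def B2_def)
qed

lemma B2_E2_hom: "(\<lambda>M. M) \<in> hom B2 (E2 :: ('a::comm_ring_1 ^ 2 ^ 2) monoid)"
  using B2_le_E2 by (auto simp: hom_def) (simp add: B2_def E2_def)

lemma amalg_cocone_E2: "amalg_cocone (B2 :: ('a::comm_ring_1 ^ 2 ^ 2) monoid) E2 B2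
    (\<lambda>M. M) const_matrix E2 const_matrix (\<lambda>M. M)"
  by (intro amalg_cocone.intro amalg_data.intro amalg_data_axioms.intro amalg_cocone_axioms.intro
      group_B2 group_E2 const_matrix_hom_B2 const_matrix_hom_E2 B2_E2_hom) simp

end

theory Submission
  imports Defs
begin

text \<open>
  Every word reduces to a single letter of \<open>B(R[t])\<close> or to an alternating word with letters in
  \<open>E\<^sub>2(R) - B(R)\<close> and \<open>B(R[t]) - B(R)\<close>. Follow the first column \<open>(x, y)\<close> of the value of such a word
  while letters are multiplied on from the left. The units of \<open>R[t]\<close> are constant, so a letter of
  \<open>B(R[t]) - B(R)\<close> has a nonconstant upper right entry and turns \<open>deg x \<le> deg y\<close> into
  \<open>deg x > deg y\<close>; a letter of \<open>E\<^sub>2(R) - B(R)\<close> has a nonzero lower left entry and turns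
  \<open>deg x > deg y\<close> into \<open>deg x \<le> deg y\<close>. Throughout \<open>y \<noteq> 0\<close>, so the value is not the identity.
\<close>

section \<open>Reduced words in an amalgamated product and injectivity of maps out of it\<close>

context amalg_data
begin

text \<open>
  The last letter always lies in \<open>H\<close> and may be in the amalgamated subgroup, even trivial: this
  treats words ending in \<open>G\<close> and in \<open>H\<close> at once.
\<close>

inductive_set reducedL :: "('a + 'b) list set" and reducedR :: "('a + 'b) list set" where
  last: "\<lbrakk>x \<in> carrier G; x \<notin> i ` carrier C; y \<in> carrier H\<rbrakk> \<Longrightarrow> [Inl x, Inr y] \<in> reducedL"
| left: "\<lbrakk>x \<in> carrier G; x \<notin> i ` carrier C; w \<in> reducedR\<rbrakk> \<Longrightarrow> Inl x # w \<in> reducedL"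
| right: "\<lbrakk>y \<in> carrier H; y \<notin> j ` carrier C; w \<in> reducedL\<rbrakk> \<Longrightarrow> Inr y # w \<in> reducedR"

lemma reduced_words:
  shows reducedL_words: "w \<in> reducedL \<Longrightarrow> w \<in> W"
    and reducedR_words: "w \<in> reducedR \<Longrightarrow> w \<in> W"
  by (induction rule: reducedL_reducedR.inducts) auto

text \<open>A single letter of \<open>H\<close> also represents the empty word and the letters
  \<open>i c\<close>. No coset representatives are chosen, so a class may contain several of these
  words.\<close>

definition normal_words :: "('a + 'b) list set"
  where "normal_words = {[Inr y] | y. y \<in> carrier H} \<union> reducedL \<union> reducedR"

lemma rel_replace_prefix:
  assumes "(u, u') \<in> R" "w \<in> W"
  shows "(u @ w, u' @ w) \<in> R"
  using assms by (intro amalg_rel.append amalg_rel.refl)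

lemma rel_Cons_mult_left:
  assumes "x \<in> carrier G" "x' \<in> carrier G" "w \<in> W"
  shows "(Inl x # Inl x' # w, Inl (x \<otimes>\<^bsub>G\<^esub> x') # w) \<in> R"
  using rel_replace_prefix[OF amalg_rel.mult_left[OF assms(1,2)] assms(3)] by simp

lemma rel_Cons_mult_right:
  assumes "y \<in> carrier H" "y' \<in> carrier H" "w \<in> W"
  shows "(Inr y # Inr y' # w, Inr (y \<otimes>\<^bsub>H\<^esub> y') # w) \<in> R"
  using rel_replace_prefix[OF amalg_rel.mult_right[OF assms(1,2)] assms(3)] by simp

lemma rel_Cons_amalg:
  assumes "c \<in> carrier C" "w \<in> W"
  shows "(Inl (i c) # w, Inr (j c) # w) \<in> R"
  using rel_replace_prefix[OF amalg_rel.amalg[OF assms(1)] assms(2)] by simp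

lemma i_closed: "c \<in> carrier C \<Longrightarrow> i c \<in> carrier G"
  using hom_in_carrier[OF i_hom] .

lemma j_closed: "c \<in> carrier C \<Longrightarrow> j c \<in> carrier H"
  using hom_in_carrier[OF j_hom] .

text \<open>The image of \<open>i\<close> is a subgroup. Hence a letter outside it stays outside
  after absorbing \<open>i c\<close>, which keeps reduced words reduced.\<close>

lemma i_image_mult_iff:
  assumes "c \<in> carrier C" "x \<in> carrier G"
  shows "i c \<otimes>\<^bsub>G\<^esub> x \<in> i ` carrier C \<longleftrightarrow> x \<in> i ` carrier C"
proof -
  interpret group_hom C G i
    by (intro group_hom.intro group_hom_axioms.intro C.is_group G.is_group i_hom)
  have "x = inv\<^bsub>G\<^esub> (i c) \<otimes>\<^bsub>G\<^esub> (i c \<otimes>\<^bsub>G\<^esub> x)"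
    using assms by (simp flip: G.m_assoc)
  then show ?thesis
    using assms subgroup.m_closed[OF img_is_subgroup] subgroup.m_inv_closed[OF img_is_subgroup]
    by (metis imageI)
qed

lemma j_image_mult_iff:
  assumes "c \<in> carrier C" "y \<in> carrier H"
  shows "j c \<otimes>\<^bsub>H\<^esub> y \<in> j ` carrier C \<longleftrightarrow> y \<in> j ` carrier C"
proof -
  interpret group_hom C H j
    by (intro group_hom.intro group_hom_axioms.intro C.is_group H.is_group j_hom)
  have "y = inv\<^bsub>H\<^esub> (j c) \<otimes>\<^bsub>H\<^esub> (j c \<otimes>\<^bsub>H\<^esub> y)"
    using assms by (simp flip: H.m_assoc)
  then show ?thesis
    using assms subgroup.m_closed[OF img_is_subgroup] subgroup.m_inv_closed[OF img_is_subgroup]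
    by (metis imageI)
qed

lemma normalise_amalg_reducedL:
  assumes c: "c \<in> carrier C" and w: "w \<in> reducedL"
  shows "\<exists>w'\<in>reducedL. (Inl (i c) # w, w') \<in> R"
  using w
proof cases
  case (last x y)
  then have "(Inl (i c) # w, [Inl (i c \<otimes>\<^bsub>G\<^esub> x), Inr y]) \<in> R"
    using rel_Cons_mult_left c i_closed by simp
  moreover have "[Inl (i c \<otimes>\<^bsub>G\<^esub> x), Inr y] \<in> reducedL"
    using last c i_closed by (intro reducedL_reducedR.intros) (auto simp: i_image_mult_iff)
  ultimately show ?thesis by blast
next
  case (left x v)
  then have "(Inl (i c) # w, Inl (i c \<otimes>\<^bsub>G\<^esub> x) # v) \<in> R"
    using rel_Cons_mult_left c i_closed reducedR_words by simp
  moreover have "Inl (i c \<otimes>\<^bsub>G\<^esub> x) # v \<in> reducedL"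
    using left c i_closed by (intro reducedL_reducedR.intros) (auto simp: i_image_mult_iff)
  ultimately show ?thesis by blast
qed

lemma normalise_amalg_reducedR:
  assumes c: "c \<in> carrier C" and w: "w \<in> reducedR"
  shows "\<exists>w'\<in>reducedR. (Inr (j c) # w, w') \<in> R"
  using w
proof cases
  case (right y v)
  then have "(Inr (j c) # w, Inr (j c \<otimes>\<^bsub>H\<^esub> y) # v) \<in> R"
    using rel_Cons_mult_right c j_closed reducedL_words by simp
  moreover have "Inr (j c \<otimes>\<^bsub>H\<^esub> y) # v \<in> reducedR"
    using right c j_closed by (intro reducedL_reducedR.intros) (auto simp: j_image_mult_iff)
  ultimately show ?thesis by blast
qed

lemma normalise_Inr:
  assumes y: "y \<in> carrier H" and w: "w \<in> normal_words"
  shows "\<exists>w'\<in>normal_words. (Inr y # w, w') \<in> R"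
proof -
  \<comment> \<open>Stated for every letter of \<open>H\<close>, because merging two
    \<open>H\<close>-letters below can yield an element coming from \<open>C\<close>. Such an
    element moves to the \<open>G\<close> side and is absorbed by the first letter of
    \<open>v\<close>.\<close>
  have RL: "\<exists>w'\<in>normal_words. (Inr y # v, w') \<in> R"
    if v: "v \<in> reducedL" and y: "y \<in> carrier H" for v y
  proof (cases "y \<in> j ` carrier C")
    case True
    then obtain c where c: "c \<in> carrier C" "y = j c" by blast
    then obtain w' where "w' \<in> reducedL" "(Inl (i c) # v, w') \<in> R"
      using normalise_amalg_reducedL v by blast
    moreover have "(Inr y # v, Inl (i c) # v) \<in> R"
      using amalg_rel.sym[OF rel_Cons_amalg] c reducedL_words[OF v] by simp
    ultimately show ?thesis unfolding normal_words_def by (blast intro: amalg_rel.trans)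
  next
    case False
    then have "Inr y # v \<in> reducedR" using v y by (intro reducedL_reducedR.intros)
    then show ?thesis unfolding normal_words_def
      by (blast intro: amalg_rel.refl reducedR_words)
  qed
  consider y' where "y' \<in> carrier H" "w = [Inr y']" | "w \<in> reducedL" | "w \<in> reducedR"
    using w by (auto simp: normal_words_def)
  then show ?thesis
  proof cases
    case 1
    then show ?thesis using rel_Cons_mult_right[OF y, of y' "[]"] y
      by (auto simp: normal_words_def)
  next
    case 2
    then show ?thesis using RL y by blast
  next
    case 3
    then show ?thesis
    proof cases
      case (right y' v)
      then have "(Inr y # w, Inr (y \<otimes>\<^bsub>H\<^esub> y') # v) \<in> R"
        using rel_Cons_mult_right y reducedL_words by simp
      then show ?thesis using RL[of v "y \<otimes>\<^bsub>H\<^esub> y'"] right y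
        by (blast intro: amalg_rel.trans H.m_closed)
    qed
  qed
qed

text \<open>A letter from the image of \<open>C\<close> moves to the \<open>H\<close> side, where
  \<open>normalise_Inr\<close> applies; any other one extends the word. If the word already begins
  in \<open>G\<close>, the two letters are merged first.\<close>

lemma normalise_Inl:
  assumes x: "x \<in> carrier G" and w: "w \<in> normal_words"
  shows "\<exists>w'\<in>normal_words. (Inl x # w, w') \<in> R"
proof -
  have RR: "\<exists>w'\<in>normal_words. (Inl x # v, w') \<in> R"
    if v: "v \<in> reducedR \<or> (\<exists>y\<in>carrier H. v = [Inr y])" and x: "x \<in> carrier G" for v x
  proof (cases "x \<in> i ` carrier C")
    case True
    then obtain c where c: "c \<in> carrier C" "x = i c" by blast
    have vn: "v \<in> normal_words" "v \<in> W"
      using v reducedR_words by (auto simp: normal_words_def)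
    then obtain w' where "w' \<in> normal_words" "(Inr (j c) # v, w') \<in> R"
      using normalise_Inr c j_closed by blast
    moreover have "(Inl x # v, Inr (j c) # v) \<in> R"
      using rel_Cons_amalg c vn by simp
    ultimately show ?thesis by (blast intro: amalg_rel.trans)
  next
    case False
    then have "Inl x # v \<in> reducedL" using v x by (auto intro: reducedL_reducedR.intros)
    then show ?thesis unfolding normal_words_def
      by (blast intro: amalg_rel.refl reducedL_words)
  qed
  consider "w \<in> reducedR \<or> (\<exists>y\<in>carrier H. w = [Inr y])" | "w \<in> reducedL"
    using w by (auto simp: normal_words_def)
  then show ?thesis
  proof cases
    case 1
    then show ?thesis using RR x by blast
  next
    case 2
    then obtain x' v where v: "w = Inl x' # v" "x' \<in> carrier G"
      "v \<in> reducedR \<or> (\<exists>y\<in>carrier H. v = [Inr y])"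
      by cases auto
    then have "v \<in> W" using reducedR_words by auto
    then have "(Inl x # w, Inl (x \<otimes>\<^bsub>G\<^esub> x') # v) \<in> R"
      using rel_Cons_mult_left x v by simp
    then show ?thesis using RR[of v "x \<otimes>\<^bsub>G\<^esub> x'"] v x
      by (blast intro: amalg_rel.trans G.m_closed)
  qed
qed

lemma normal_form: "w \<in> W \<Longrightarrow> \<exists>w'\<in>normal_words. (w, w') \<in> R"
proof (induction w)
  case Nil
  \<comment> \<open>The empty word is not in \<open>normal_words\<close>; the identity letter of
    \<open>H\<close> stands for it.\<close>
  have "([], [Inr \<one>\<^bsub>H\<^esub>]) \<in> R" by (intro amalg_rel.sym[OF amalg_rel.one_right])
  then show ?case by (auto simp: normal_words_def)
next
  case (Cons l w)
  then have l: "[l] \<in> W" "w \<in> W" by (cases l; simp)+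
  with Cons obtain w' where w': "w' \<in> normal_words" "(w, w') \<in> R" by blast
  have "(l # w, l # w') \<in> R"
    using amalg_rel.append[OF amalg_rel.refl[OF l(1)] w'(2)] by simp
  moreover have "\<exists>w''\<in>normal_words. (l # w', w'') \<in> R"
    using l w' normalise_Inl normalise_Inr by (cases l) auto
  ultimately show ?case by (blast intro: amalg_rel.trans)
qed

end

text \<open>A kernel element has a representative in \<open>normal_words\<close>. Reduced words are
  excluded by \<open>ne\<close>, and a single letter of \<open>H\<close> with value one is trivial
  since \<open>g\<close> is injective.\<close>

lemma (in amalg_cocone) amalg_lift_inj:
  assumes g: "inj_on g (carrier H)"
    and ne: "\<And>w. w \<in> reducedL \<union> reducedR \<Longrightarrow> amalg_eval K f g w \<noteq> \<one>\<^bsub>K\<^esub>"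
  shows "inj_on (amalg_lift K f g) (carrier P)"
proof -
  interpret group_hom P K "amalg_lift K f g"
    by (intro group_hom.intro group_hom_axioms.intro group_P K.is_group amalg_lift_hom)
  have "X = \<one>\<^bsub>P\<^esub>" if X: "X \<in> carrier P" and X1: "amalg_lift K f g X = \<one>\<^bsub>K\<^esub>" for X
  proof -
    obtain w where w: "w \<in> W" "X = R `` {w}" using X by (auto simp: carrier_P)
    obtain w' where w': "w' \<in> normal_words" "(w, w') \<in> R" using normal_form w by blast
    have "amalg_eval K f g w' = \<one>\<^bsub>K\<^esub>"
      using w X1 amalg_eval_cong[OF w'(2)] by (simp add: amalg_lift_class)
    then obtain y where y: "y \<in> carrier H" "w' = [Inr y]" "g y = \<one>\<^bsub>K\<^esub>"
      using w' ne hom_in_carrier[OF g_hom] by (force simp: normal_words_def)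
    then have "y = \<one>\<^bsub>H\<^esub>"
      using inj_onD[OF g, of y "\<one>\<^bsub>H\<^esub>"] Group.hom_one[OF g_hom H.is_group K.is_group] by simp
    then have "(w, []) \<in> R" using w' y amalg_rel.one_right by (blast intro: amalg_rel.trans)
    then show ?thesis using w equiv_class_eq[OF equiv_rel] by (simp add: one_P)
  qed
  then show ?thesis by (intro inj_onI) (metis inj_on_one_iff inj_onD)
qed

section \<open>Degrees in the first column over the polynomial ring\<close>

lemma const_matrix_nth: "const_matrix M $ p $ q = [:M $ p $ q:]"
  by (simp add: const_matrix_def)

text \<open>The diagonal entries are mutually inverse units, hence constant over a domain. If the
  upper right entry were constant too, the matrix would come from \<open>B2\<close> over
  \<open>'a\<close>.\<close>

lemma B2_poly_entries:
  fixes M :: "'a::idom poly ^ 2 ^ 2"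
  assumes M: "M \<in> carrier B2"
  shows "degree (M $ 1 $ 1) = 0" "degree (M $ 2 $ 2) = 0" "M $ 2 $ 2 \<noteq> 0" "M $ 2 $ 1 = 0"
    and "M \<notin> const_matrix ` carrier B2 \<Longrightarrow> degree (M $ 1 $ 2) > 0"
proof -
  have 1: "M $ 1 $ 1 * M $ 2 $ 2 = 1" and 0: "M $ 2 $ 1 = 0"
    using M by (auto simp: B2_def det_2)
  then have nz: "M $ 1 $ 1 \<noteq> 0" "M $ 2 $ 2 \<noteq> 0" by auto
  then have deg: "degree (M $ 1 $ 1) + degree (M $ 2 $ 2) = 0"
    using arg_cong[OF 1, of degree] by (simp add: degree_mult_eq)
  then show "degree (M $ 1 $ 1) = 0" "degree (M $ 2 $ 2) = 0" "M $ 2 $ 2 \<noteq> 0" "M $ 2 $ 1 = 0"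
    using nz 0 by auto
  show "degree (M $ 1 $ 2) > 0" if "M \<notin> const_matrix ` carrier B2"
  proof (rule ccontr)
    assume "\<not> degree (M $ 1 $ 2) > 0"
    then obtain a b d where abd: "M $ 1 $ 1 = [:a:]" "M $ 1 $ 2 = [:b:]" "M $ 2 $ 2 = [:d:]"
      using deg by (metis add_is_0 degree_eq_zeroE not_gr_zero)
    define N :: "'a ^ 2 ^ 2" where "N = vector [vector [a, b], vector [0, d]]"
    have "M = const_matrix N" "N \<in> carrier B2"
      using 0 1 abd by (auto simp: mat2_eq_iff const_matrix_nth N_def B2_def det_2 one_pCons mult.commute)
    with that show False by blast
  qed
qed

text \<open>A nonzero scalar times \<open>x\<close> dominates the lower entry, so its degree is
  exactly \<open>degree x\<close>; the upper entry cannot exceed that.\<close>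

lemma const_not_B2_first_column:
  fixes M :: "'a::idom ^ 2 ^ 2" and x y :: "'a poly"
  assumes "M $ 2 $ 1 \<noteq> 0" "degree y < degree x"
  defines "x' \<equiv> const_matrix M $ 1 $ 1 * x + const_matrix M $ 1 $ 2 * y"
    and "y' \<equiv> const_matrix M $ 2 $ 1 * x + const_matrix M $ 2 $ 2 * y"
  shows "y' \<noteq> 0 \<and> degree x' \<le> degree y'"
proof -
  have x': "x' = smult (M $ 1 $ 1) x + smult (M $ 1 $ 2) y"
    and y': "y' = smult (M $ 2 $ 1) x + smult (M $ 2 $ 2) y"
    by (simp_all add: x'_def y'_def const_matrix_nth)
  have "degree (smult c y) < degree x" for c :: 'a
    using degree_smult_le[of c y] assms(2) by simp
  then have "degree y' = degree x" unfolding y'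
    using assms(1) by (subst degree_add_eq_left) auto
  moreover have "degree x' \<le> degree x" unfolding x'
    using assms(2) by (intro degree_add_le) (auto intro: order.trans[OF degree_smult_le])
  \<comment> \<open>\<open>degree y' = degree x\<close> is positive, so \<open>y'\<close> is
    nonzero.\<close>
  ultimately show ?thesis using assms(2) by auto
qed

text \<open>The lower entry is a nonzero constant times \<open>y\<close>. In the upper entry
  \<open>M $ 1 $ 2 * y\<close> outgrows the other summand, whose degree is at most
  \<open>degree y\<close>.\<close>

lemma B2_nonconst_first_column:
  fixes M :: "'a::idom poly ^ 2 ^ 2" and x y :: "'a poly"
  assumes M: "M \<in> carrier B2" "M \<notin> const_matrix ` carrier B2"
    and xy: "y \<noteq> 0" "degree x \<le> degree y"
  defines "x' \<equiv> M $ 1 $ 1 * x + M $ 1 $ 2 * y" and "y' \<equiv> M $ 2 $ 1 * x + M $ 2 $ 2 * y"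
  shows "y' \<noteq> 0 \<and> degree y' < degree x'"
proof -
  note e = B2_poly_entries[OF M(1)] and f = B2_poly_entries(5)[OF M]
  have y': "y' \<noteq> 0" "degree y' = degree y"
    using e xy by (simp_all add: y'_def degree_mult_eq)
  have fy: "degree (M $ 1 $ 2 * y) = degree (M $ 1 $ 2) + degree y"
    using f xy by (subst degree_mult_eq) auto
  have "degree (M $ 1 $ 1 * x) < degree (M $ 1 $ 2 * y)"
    using degree_mult_le[of "M $ 1 $ 1" x] e f xy unfolding fy by simp
  then have "degree x' = degree (M $ 1 $ 2) + degree y"
    unfolding x'_def by (simp add: degree_add_eq_right fy)
  then show ?thesis using y' f by simp
qed

section \<open>Elementary matrices and their determinants\<close>

lemma mult_E2: "M \<otimes>\<^bsub>E2\<^esub> N = M ** N" and one_E2: "\<one>\<^bsub>E2\<^esub> = mat 1"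
  by (simp_all add: E2_def GL2_def)

text \<open>Checked on generators and carried through products and inverses. It makes
  \<open>B2\<close> the part of \<open>E2\<close> with lower left entry zero, so that entry detects
  letters outside \<open>B2\<close>.\<close>

lemma det_E2: "M \<in> carrier E2 \<Longrightarrow> det M = 1" for M :: "'a::comm_ring_1 ^ 2 ^ 2"
proof -
  have el: "det (elementary_matrix p q a) = 1" if "p \<noteq> q" for p q and a :: 'a
    using that exhaust_2[of p] exhaust_2[of q] by (auto simp: det_2 elementary_matrix_def)
  assume "M \<in> carrier E2"
  then have "M \<in> generate GL2 {elementary_matrix p q a | p q a. p \<noteq> q}" by (simp add: E2_def)
  then show ?thesis
  proof induction
    case (inv h)
    then have "h \<in> carrier GL2" using elementary_in_GL2 by blast
    then have "inv\<^bsub>GL2\<^esub> h ** h = mat 1"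
      using group.l_inv[OF group_GL2] by (fastforce simp: GL2_def)
    then have "det (inv\<^bsub>GL2\<^esub> h) * det h = 1" by (metis det_mul det_I)
    then show ?case using inv el by auto
  qed (auto simp: el GL2_def det_mul)
qed

lemma elementary_in_E2: "p \<noteq> q \<Longrightarrow> elementary_matrix p q a \<in> carrier E2"
  by (auto simp: E2_def intro!: generate.incl)

lemma E2_not_B2_entry:
  assumes "M \<in> carrier E2" "M \<notin> carrier B2"
  shows "M $ 2 $ 1 \<noteq> 0"
  using assms det_E2 by (auto simp: B2_def)

section \<open>Ping-pong on the first column, then surjectivity\<close>

theorem corollary1p2:
  shows "amalg_lift E2 const_matrix (\<lambda>M. M)
    \<in> iso (amalg_product (B2 :: ('a::idom ^ 2 ^ 2) monoid) E2 B2 (\<lambda>M. M) const_matrix)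
        (E2 :: ('a poly ^ 2 ^ 2) monoid)"
proof -
  interpret amalg_cocone "B2 :: ('a ^ 2 ^ 2) monoid" E2 B2
    "\<lambda>M. M" const_matrix E2 const_matrix "\<lambda>M. M"
    by (rule amalg_cocone_E2)
  let ?ev = "amalg_eval E2 const_matrix (\<lambda>M. M) :: ('a ^ 2 ^ 2 + 'a poly ^ 2 ^ 2) list \<Rightarrow> _"
  let ?\<phi> = "amalg_lift E2 const_matrix (\<lambda>M. M) :: ('a ^ 2 ^ 2 + 'a poly ^ 2 ^ 2) list set \<Rightarrow> _"
  have column: "w \<in> reducedL \<Longrightarrow> ?ev w $ 2 $ 1 \<noteq> 0 \<and> degree (?ev w $ 1 $ 1) \<le> degree (?ev w $ 2 $ 1)"
    "w \<in> reducedR \<Longrightarrow> ?ev w $ 2 $ 1 \<noteq> 0 \<and> degree (?ev w $ 2 $ 1) < degree (?ev w $ 1 $ 1)" for w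
  proof (induction rule: reducedL_reducedR.inducts)
    \<comment> \<open>The first column of \<open>y\<close> is a nonzero constant over zero, so both
      entries of the new column are constants, and the lower one is nonzero by
      \<open>nz\<close>.\<close>
    case (last x y)
    have nz: "x $ 2 $ 1 \<noteq> 0" using last E2_not_B2_entry by auto
    have "y $ 1 $ 1 \<noteq> 0" using last by (auto simp: B2_def det_2)
    then show ?case using nz B2_poly_entries[OF last(3)]
      by (simp add: mult_E2 one_E2 mult2_nth mat2_nth const_matrix_nth)
  next
    case (left x w)
    then show ?case using const_not_B2_first_column[OF E2_not_B2_entry[of x]]
      by (simp add: mult_E2 mult2_nth)
  next
    case (right y w)
    then show ?case using B2_nonconst_first_column[of y]
      by (simp add: mult_E2 mult2_nth)
  qed
  have "inj_on ?\<phi> (carrier P)"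
  proof (rule amalg_lift_inj)
    show "?ev w \<noteq> \<one>\<^bsub>E2\<^esub>" if "w \<in> reducedL \<union> reducedR" for w
    proof
      assume "?ev w = \<one>\<^bsub>E2\<^esub>"
      then have "?ev w $ 2 $ 1 = 0" by (simp add: one_E2 mat2_nth)
      then show False using that column by blast
    qed
  qed simp
  \<comment> \<open>The image contains the upper elementary matrices, which lie in \<open>B2\<close>
    over polynomials. The lower ones arise from these by conjugation with a constant matrix from
    \<open>E2\<close>.\<close>
  moreover have "carrier E2 \<subseteq> ?\<phi> ` carrier P"
  proof -
    interpret lift: group_hom P E2 ?\<phi>
      by (intro group_hom.intro group_hom_axioms.intro group_P K.is_group amalg_lift_hom)
    \<comment> \<open>\<open>E2\<close> is generated inside \<open>GL2\<close>, so minimality of the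
      generated group asks for a subgroup of \<open>GL2\<close>.\<close>
    have sub: "subgroup (?\<phi> ` carrier P) GL2"
      using group.incl_subgroup[OF group_GL2 subgroup_E2] lift.img_is_subgroup
      by (simp add: E2_def)
    have ev: "?ev w \<in> ?\<phi> ` carrier P" if "w \<in> W" for w
      using that by (auto simp: carrier_P amalg_lift_class[symmetric])
    have upper: "elementary_matrix 1 2 a \<in> carrier B2" for a :: "'a poly"
      by (simp add: B2_def elementary_matrix_def det_2)
    have "elementary_matrix 1 2 a \<in> ?\<phi> ` carrier P" for a
      using ev[of "[Inr (elementary_matrix 1 2 a)]"] upper by (simp add: mult_E2 one_E2)
    moreover have "elementary_matrix 2 1 a \<in> ?\<phi> ` carrier P" for a
    proof -
      \<comment> \<open>For \<open>c = 1\<close> this is the Weyl element, and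
        \<open>s (- 1)\<close> is its inverse. Conjugation by it swaps upper and lower elementary
        matrices and flips the sign, hence the entry \<open>- a\<close> below.\<close>
      define s :: "'a \<Rightarrow> 'a ^ 2 ^ 2" where
        "s c = elementary_matrix 1 2 c ** (elementary_matrix 2 1 (- c) ** elementary_matrix 1 2 c)" for c
      have s: "s 1 = vector [vector [0, 1], vector [- 1, 0]]"
        "s (- 1) = vector [vector [0, - 1], vector [1, 0]]"
        by (simp_all add: s_def mat2_eq_iff mult2_nth elementary_matrix_def)
      have "s c \<in> carrier E2" for c
        unfolding s_def mult_E2[symmetric] by (intro G.m_closed elementary_in_E2) simp_all
      then have "?ev [Inl (s 1), Inr (elementary_matrix 1 2 (- a)), Inl (s (- 1))] \<in> ?\<phi> ` carrier P"
        using upper by (intro ev) simp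
      moreover have "?ev [Inl (s 1), Inr (elementary_matrix 1 2 (- a)), Inl (s (- 1))] = elementary_matrix 2 1 a"
        by (simp add: mult_E2 one_E2 s mat2_eq_iff mult2_nth mat2_nth const_matrix_nth
            elementary_matrix_def)
      ultimately show ?thesis by metis
    qed
    ultimately have "elementary_matrix p q a \<in> ?\<phi> ` carrier P" if "p \<noteq> q" for p q a
      using that exhaust_2[of p] exhaust_2[of q] by metis
    then have "generate GL2 {elementary_matrix p q a | p q a. p \<noteq> q} \<subseteq> ?\<phi> ` carrier P"
      by (intro group.generate_subgroup_incl[OF group_GL2 _ sub]) blast
    then show ?thesis by (simp add: E2_def)
  qed
  ultimately show ?thesis
    unfolding iso_def bij_betw_def using amalg_lift_hom hom_carrier[OF amalg_lift_hom] by blast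
qed

end
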